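(* Let $K$ be a field, $E$ a non-empty set, and let $\{0\}\neq W\subset K^E$ be a finite-dimensional $K$-vector subspace. Then $M(W)=(E,\mathcal C(W))$ is a matroid, i.e. $\mathcal C(W)$ is the set of circuits of a matroid on $E$. Moreover, any element of $\mathcal T(W)$ is a union of circuits, i.e. a union of elements of $\mathcal C(W)$.
   Context: For $v=(a_i)_{i\in E}\in K^E$ the support is $\mathcal T(v)=\{i\in E: a_i\ne0\}$, and $\mathcal T(W)=\{\mathcal T(v): v\in W\}\subset 2^E$. $\mathcal C(W)\subset 2^E$ is the set of elements of $\mathcal T(W)\setminus\{\emptyset\}$ that are minimal with respect to inclusion. The empty set counts as the empty union. Matroids (possibly infinite). $\mathcal C\subset 2^E$ is the set of circuits of a matroid on $E$ if: (i) $\emptyset\notin\mathcal C$; (ii) no element of $\mathcal C$ is a proper subset of another; (iii) whenever $X\subset C\in\mathcal C$ and $\{C_x: x\in X\}$ is a family in $\mathcal C$ with $x\in C_y\iff x=y$ for all $x,y\in X$, then for every $z\in C\setminus\bigcup_xC_x$ there is $C'\in\mathcal C$ with $z\in C'\subset (C\cup\bigcup_xC_x)\setminus X$; (iv) with $\mathcal I=\{I\subset E: C\not\subset I\ \forall C\in\mathcal C\}$, whenever $I\subset X\subset E$ and $I\in\mathcal I$, the set $\{I'\in\mathcal I: I\subset I'\subset X\}$ has a maximal element with respect to inclusion. *)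

theory Defs
  imports Complex_Main "HOL-Library.Function_Algebras"
begin

definition coord_scale :: "'k::field \<Rightarrow> ('e \<Rightarrow> 'k) \<Rightarrow> 'e \<Rightarrow> 'k" where
  "coord_scale c v = (\<lambda>i. c * v i)"

interpretation coord: vector_space "coord_scale :: 'k::field \<Rightarrow> ('e \<Rightarrow> 'k) \<Rightarrow> 'e \<Rightarrow> 'k"
  by unfold_locales (auto simp: coord_scale_def fun_eq_iff algebra_simps)

text \<open>The space \<open>K\<^sup>E\<close>: a family indexed by the set \<open>E\<close> is encoded as a total function that is
  zero outside \<open>E\<close>, so that each family has exactly one representative.\<close>

definition coord_space :: "'e set \<Rightarrow> ('e \<Rightarrow> 'k::field) set" where
  "coord_space E = {v. \<forall>i. i \<notin> E \<longrightarrow> v i = 0}"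

text \<open>The library's \<open>finite_dimensional_vector_space\<close> speaks about the whole type only; this is the
  same condition relative to a subspace. (\<open>dim\<close> would not do: it is 0 in the infinite-dimensional
  case.)\<close>

definition finite_dimensional :: "('e \<Rightarrow> 'k::field) set \<Rightarrow> bool" where
  "finite_dimensional W \<longleftrightarrow> (\<exists>B. finite B \<and> coord.independent B \<and> coord.span B = W)"

definition supp :: "'e set \<Rightarrow> ('e \<Rightarrow> 'k::field) \<Rightarrow> 'e set" where
  "supp E v = {i \<in> E. v i \<noteq> 0}"

definition supports :: "'e set \<Rightarrow> ('e \<Rightarrow> 'k::field) set \<Rightarrow> 'e set set" where
  "supports E W = supp E ` W"

definition min_supports :: "'e set \<Rightarrow> ('e \<Rightarrow> 'k::field) set \<Rightarrow> 'e set set" where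
  "min_supports E W =
     {C \<in> supports E W - {{}}. \<forall>D \<in> supports E W - {{}}. D \<subseteq> C \<longrightarrow> D = C}"

definition indep_subsets :: "'e set \<Rightarrow> 'e set set \<Rightarrow> 'e set set" where
  "indep_subsets E \<C> = {I. I \<subseteq> E \<and> (\<forall>C\<in>\<C>. \<not> C \<subseteq> I)}"

text \<open>Circuit axioms of a possibly infinite matroid on \<open>E\<close>. The family \<open>(C\<^sub>x)\<close> is a total
  function \<open>F\<close> of which only the values on \<open>X\<close> matter.\<close>

definition matroid_circuits :: "'e set \<Rightarrow> 'e set set \<Rightarrow> bool" where
  "matroid_circuits E \<C> \<longleftrightarrow>
     \<C> \<subseteq> Pow E \<and>
     {} \<notin> \<C> \<and>
     (\<forall>C\<in>\<C>. \<forall>D\<in>\<C>. \<not> C \<subset> D) \<and>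
     (\<forall>C\<in>\<C>. \<forall>X F. X \<subseteq> C \<longrightarrow> (\<forall>x\<in>X. F x \<in> \<C>) \<longrightarrow>
        (\<forall>x\<in>X. \<forall>y\<in>X. x \<in> F y \<longleftrightarrow> x = y) \<longrightarrow>
        (\<forall>z \<in> C - (\<Union>x\<in>X. F x). \<exists>C'\<in>\<C>. z \<in> C' \<and> C' \<subseteq> (C \<union> (\<Union>x\<in>X. F x)) - X)) \<and>
     (\<forall>I X. I \<in> indep_subsets E \<C> \<longrightarrow> I \<subseteq> X \<longrightarrow> X \<subseteq> E \<longrightarrow>
        (\<exists>M \<in> {I' \<in> indep_subsets E \<C>. I \<subseteq> I' \<and> I' \<subseteq> X}.
           \<forall>N \<in> {I' \<in> indep_subsets E \<C>. I \<subseteq> I' \<and> I' \<subseteq> X}. M \<subseteq> N \<longrightarrow> N = M))"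

end

theory Submission
  imports Defs
begin

text \<open>For \<open>A \<subseteq> E\<close> let \<open>W\<^sub>A\<close> be the space of all vectors of \<open>W\<close> whose support lies in \<open>A\<close>. Everything
  rests on one remark: if \<open>x\<close> lies in the support of a vector of \<open>W\<^sub>A\<close>, then passing from \<open>A\<close> to
  \<open>A - {x}\<close> strictly lowers the finite dimension of \<open>W\<^sub>A\<close> (lemma \<open>dim_supported_Diff_less\<close>). The only
  other tool is Gaussian elimination, \<open>v - (v x / u x) u\<close>, which cancels the coordinate \<open>x\<close> of \<open>v\<close> and
  keeps each coordinate at which \<open>u\<close> vanishes (lemma \<open>eliminate\<close>).

  Each point \<open>z\<close> of a support \<open>A\<close> lies in a circuit inside \<open>A\<close>: choose \<open>v \<in> W\<^sub>A\<close> with \<open>v z \<noteq> 0\<close> and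
  \<open>W\<^bsub>supp v\<^esub>\<close> of least dimension. If a vector \<open>u\<close> had a non-empty support strictly inside that of \<open>v\<close>, then
  either \<open>u z \<noteq> 0\<close> and \<open>u\<close> contradicts the choice of \<open>v\<close>, or \<open>u z = 0\<close> and eliminating a coordinate of
  \<open>v\<close> by means of \<open>u\<close> does. Hence supports are unions of circuits, and a set is independent iff
  it contains no non-empty support.

  In the circuit elimination axiom, let \<open>F x\<close> be the support of \<open>f\<^sub>x\<close>. The points of \<open>X\<close> can be removed from
  \<open>E\<close> one at a time, and \<open>f\<^sub>x\<close> shows that each removal lowers the dimension, so \<open>X\<close> is finite. Finitely many eliminations
  then give a vector that vanishes on \<open>X\<close> but not at \<open>z\<close>, and \<open>z\<close> lies in a circuit inside its support.

  For the maximality axiom, let \<open>I \<subseteq> X\<close> with \<open>I\<close> independent. As long as \<open>X\<close> contains a non-empty support,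
  a point of it outside \<open>I\<close> can be removed, and the dimension drops; so an independent set between \<open>I\<close> and \<open>X\<close> is
  reached by removing finitely many points. Removing as few points as possible gives a maximal one.\<close>

section \<open>Vectors supported in a subset\<close>

text \<open>The space \<open>W\<^sub>A\<close>.\<close>

definition supported :: "'e set \<Rightarrow> ('e \<Rightarrow> 'k::field) set \<Rightarrow> 'e set \<Rightarrow> ('e \<Rightarrow> 'k) set" where
  "supported E W A = {v \<in> W. supp E v \<subseteq> A}"

lemma subspace_supported:
  assumes "coord.subspace W"
  shows "coord.subspace (supported E W A)"
proof (rule coord.subspaceI)
  show "0 \<in> supported E W A"
    using coord.subspace_0[OF assms] by (simp add: supported_def supp_def)
  show "u + v \<in> supported E W A" if "u \<in> supported E W A" "v \<in> supported E W A" for u v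
  proof -
    have "supp E (u + v) \<subseteq> supp E u \<union> supp E v"
      by (auto simp: supp_def)
    then show ?thesis
      using that coord.subspace_add[OF assms] unfolding supported_def by blast
  qed
  show "coord_scale c v \<in> supported E W A" if "v \<in> supported E W A" for c v
  proof -
    have "supp E (coord_scale c v) \<subseteq> supp E v"
      by (auto simp: supp_def coord_scale_def)
    then show ?thesis
      using that coord.subspace_scale[OF assms] unfolding supported_def by blast
  qed
qed

lemma dim_psubset_less:
  fixes U V W :: "('e \<Rightarrow> 'k::field) set"
  assumes fin: "finite_dimensional W" and U: "coord.subspace U" and "U \<subset> V" "V \<subseteq> W"
  shows "coord.dim U < coord.dim V"
proof -
  obtain B where B: "finite B" "coord.span B = W"
    using fin by (auto simp: finite_dimensional_def)
  obtain BU where BU: "BU \<subseteq> U" "coord.independent BU" "U \<subseteq> coord.span BU"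
      "card BU = coord.dim U"
    using coord.basis_exists by blast
  obtain BV where BV: "BV \<subseteq> V" "coord.independent BV" "V \<subseteq> coord.span BV"
      "card BV = coord.dim V"
    using coord.basis_exists by blast
  have finV: "finite BV"
    using coord.independent_span_bound[of B BV] B BV assms by blast
  obtain v where v: "v \<in> V" "v \<notin> U"
    using \<open>U \<subset> V\<close> by blast
  have "coord.span BU \<subseteq> U"
    using BU(1) U by (rule coord.span_minimal)
  then have "v \<notin> coord.span BU"
    using v by blast
  then have "coord.independent (insert v BU)"
    using BU(2) by (rule coord.independent_insertI)
  moreover have "insert v BU \<subseteq> coord.span BV"
    using v BU BV \<open>U \<subset> V\<close> by blast
  ultimately have "finite (insert v BU) \<and> card (insert v BU) \<le> card BV"
    by (rule coord.independent_span_bound[OF finV])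
  moreover have "v \<notin> BU"
    using v BU by blast
  ultimately show ?thesis
    using BU(4) BV(4) by auto
qed

lemma dim_supported_Diff_less:
  fixes W :: "('e \<Rightarrow> 'k::field) set"
  assumes "coord.subspace W" "finite_dimensional W"
    and "v \<in> supported E W A" "x \<in> supp E v"
  shows "coord.dim (supported E W (A - {x})) < coord.dim (supported E W A)"
proof (rule dim_psubset_less[OF assms(2) subspace_supported[OF assms(1)]])
  show "supported E W (A - {x}) \<subset> supported E W A"
    using assms(3,4) by (auto simp: supported_def)
qed (auto simp: supported_def)

section \<open>Elimination and circuits\<close>

lemma eliminate:
  fixes W :: "('e \<Rightarrow> 'k::field) set"
  assumes "coord.subspace W" "v \<in> W" "u \<in> W" "x \<in> supp E u"
  obtains w where "w \<in> W" "supp E w \<subseteq> (supp E v \<union> supp E u) - {x}"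
    "\<And>z. u z = 0 \<Longrightarrow> w z = v z"
proof
  let ?w = "v - coord_scale (v x / u x) u"
  show "?w \<in> W"
    using assms by (intro coord.subspace_diff coord.subspace_scale)
  show "supp E ?w \<subseteq> (supp E v \<union> supp E u) - {x}"
    using assms(4) by (auto simp: supp_def coord_scale_def)
  show "?w z = v z" if "u z = 0" for z
    using that by (simp add: coord_scale_def)
qed

lemma circuit_through_point:
  fixes W :: "('e \<Rightarrow> 'k::field) set"
  assumes sub: "coord.subspace W" and fin: "finite_dimensional W"
    and w: "w \<in> W" "z \<in> supp E w"
  obtains C where "C \<in> min_supports E W" "z \<in> C" "C \<subseteq> supp E w"
proof -
  define P where "P v \<longleftrightarrow> v \<in> supported E W (supp E w) \<and> z \<in> supp E v" for v
  have "P w"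
    using w by (simp add: P_def supported_def)
  then obtain v where v: "P v"
    and least: "\<And>u. P u \<Longrightarrow> coord.dim (supported E W (supp E v)) \<le> coord.dim (supported E W (supp E u))"
    using ex_has_least_nat[of P w "\<lambda>v. coord.dim (supported E W (supp E v))"] by blast
  have vW: "v \<in> W" and vw: "supp E v \<subseteq> supp E w" and zv: "z \<in> supp E v"
    using v by (auto simp: P_def supported_def)
  have minimal: "supp E u = supp E v"
    if u: "u \<in> W" "z \<in> supp E u" "supp E u \<subseteq> supp E v" for u
  proof (rule ccontr)
    assume "supp E u \<noteq> supp E v"
    then have "supported E W (supp E u) \<subset> supported E W (supp E v)"
      using u vW by (auto simp: supported_def)
    then have "coord.dim (supported E W (supp E u)) < coord.dim (supported E W (supp E v))"
      by (rule dim_psubset_less[OF fin subspace_supported[OF sub]]) (auto simp: supported_def)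
    moreover have "P u"
      using u vw by (auto simp: P_def supported_def)
    ultimately show False
      using least by fastforce
  qed
  have "supp E u = supp E v" if u: "u \<in> W" "supp E u \<noteq> {}" "supp E u \<subseteq> supp E v" for u
  proof (cases "z \<in> supp E u")
    case True
    then show ?thesis
      using minimal u by blast
  next
    case False
    obtain x where x: "x \<in> supp E u"
      using u by blast
    from eliminate[OF sub vW \<open>u \<in> W\<close> x] obtain v' where v': "v' \<in> W"
      "supp E v' \<subseteq> (supp E v \<union> supp E u) - {x}" "\<And>y. u y = 0 \<Longrightarrow> v' y = v y"
      by blast
    have "z \<in> supp E v'"
      using False zv v'(3)[of z] by (auto simp: supp_def)
    then have "supp E v' = supp E v"
      using minimal v' u by blast
    \<comment> \<open>This is absurd: \<open>x\<close> lies in the support of \<open>v\<close>, but not in that of \<open>v'\<close>.\<close>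
    then show ?thesis
      using v'(2) x u(3) by blast
  qed
  then have "supp E v \<in> min_supports E W"
    using vW zv by (auto simp: min_supports_def supports_def)
  then show thesis
    using that zv vw by blast
qed

lemma support_eq_Union_circuits:
  fixes W :: "('e \<Rightarrow> 'k::field) set"
  assumes "coord.subspace W" "finite_dimensional W" "A \<in> supports E W"
  shows "\<exists>\<D> \<subseteq> min_supports E W. A = \<Union>\<D>"
proof (intro exI conjI)
  obtain w where w: "w \<in> W" "A = supp E w"
    using assms(3) by (auto simp: supports_def)
  show "A = \<Union>{C \<in> min_supports E W. C \<subseteq> A}"
    using circuit_through_point[OF assms(1,2) w(1)] w(2) by blast
qed blast

lemma indep_subsets_min_supports_iff:
  fixes W :: "('e \<Rightarrow> 'k::field) set"
  assumes "coord.subspace W" "finite_dimensional W"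
  shows "I \<in> indep_subsets E (min_supports E W) \<longleftrightarrow>
    I \<subseteq> E \<and> (\<forall>v \<in> supported E W I. supp E v = {})"
proof
  assume I: "I \<in> indep_subsets E (min_supports E W)"
  have "supp E v = {}" if "v \<in> W" "supp E v \<subseteq> I" for v
  proof (rule ccontr)
    assume "supp E v \<noteq> {}"
    then obtain z where "z \<in> supp E v"
      by blast
    then obtain C where "C \<in> min_supports E W" "C \<subseteq> supp E v"
      using circuit_through_point[OF assms \<open>v \<in> W\<close>] by blast
    then show False
      using I that unfolding indep_subsets_def by blast
  qed
  then show "I \<subseteq> E \<and> (\<forall>v \<in> supported E W I. supp E v = {})"
    using I by (auto simp: indep_subsets_def supported_def)
next
  assume "I \<subseteq> E \<and> (\<forall>v \<in> supported E W I. supp E v = {})"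
  then show "I \<in> indep_subsets E (min_supports E W)"
    by (fastforce simp: indep_subsets_def min_supports_def supports_def supported_def)
qed

section \<open>The circuit elimination axiom\<close>

text \<open>The hypothesis \<open>diag\<close> says that the vectors \<open>f x\<close>, restricted to the coordinates in \<open>X\<close>, form a diagonal
  matrix with non-zero diagonal entries.\<close>

lemma finite_if_diagonal:
  fixes W :: "('e \<Rightarrow> 'k::field) set"
  assumes sub: "coord.subspace W" and fin: "finite_dimensional W"
    and f: "\<And>x. x \<in> X \<Longrightarrow> f x \<in> W"
    and diag: "\<And>x y. x \<in> X \<Longrightarrow> y \<in> X \<Longrightarrow> x \<in> supp E (f y) \<longleftrightarrow> x = y"
  shows "finite X"
proof (rule ccontr)
  assume "infinite X"
  \<comment> \<open>For \<open>x \<in> X - Y\<close> the vector \<open>f x\<close> vanishes on \<open>Y\<close> but not at \<open>x\<close>, so removing \<open>x\<close> lowers the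
    dimension.\<close>
  have bound: "coord.dim (supported E W (E - Y)) + card Y \<le> coord.dim (supported E W E)"
    if "finite Y" "Y \<subseteq> X" for Y
    using that
  proof (induction Y rule: finite_induct)
    case empty
    then show ?case by simp
  next
    case (insert x Y)
    have "f x \<in> supported E W (E - Y)"
      using insert.prems insert.hyps f diag by (auto simp: supported_def supp_def)
    moreover have "x \<in> supp E (f x)"
      using insert.prems diag by blast
    ultimately have "coord.dim (supported E W ((E - Y) - {x})) < coord.dim (supported E W (E - Y))"
      by (rule dim_supported_Diff_less[OF sub fin])
    moreover have "(E - Y) - {x} = E - insert x Y"
      by blast
    ultimately show ?case
      using insert by simp
  qed
  obtain Y where "finite Y" "card Y = Suc (coord.dim (supported E W E))" "Y \<subseteq> X"
    using infinite_arbitrarily_large[OF \<open>infinite X\<close>] by blast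
  then show False
    using bound[of Y] by simp
qed

lemma eliminate_finite:
  fixes W :: "('e \<Rightarrow> 'k::field) set"
  assumes sub: "coord.subspace W" and c: "c \<in> W" and "finite X"
    and f: "\<And>x. x \<in> X \<Longrightarrow> f x \<in> W"
    and diag: "\<And>x y. x \<in> X \<Longrightarrow> y \<in> X \<Longrightarrow> x \<in> supp E (f y) \<longleftrightarrow> x = y"
    and z: "z \<in> supp E c" "\<And>x. x \<in> X \<Longrightarrow> z \<notin> supp E (f x)"
  shows "\<exists>w\<in>W. z \<in> supp E w \<and> supp E w \<subseteq> (supp E c \<union> (\<Union>x\<in>X. supp E (f x))) - X"
  using \<open>finite X\<close> f diag z(2)
proof (induction X rule: finite_induct)
  case empty
  then show ?case using c z(1) by auto
next
  case (insert x X)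
  then obtain w where w: "w \<in> W" "z \<in> supp E w"
      "supp E w \<subseteq> (supp E c \<union> (\<Union>x\<in>X. supp E (f x))) - X"
    by auto
  have "f x \<in> W" "x \<in> supp E (f x)"
    using insert.prems by auto
  then obtain w' where w': "w' \<in> W" "supp E w' \<subseteq> (supp E w \<union> supp E (f x)) - {x}"
      "\<And>y. f x y = 0 \<Longrightarrow> w' y = w y"
    using eliminate[OF sub w(1)] by blast
  have "z \<in> supp E w'"
    using w(2) w'(3)[of z] insert.prems(3)[of x] by (auto simp: supp_def)
  moreover have "supp E (f x) \<inter> X = {}"
    using insert.prems(2) insert.hyps(2) by blast
  then have "supp E w' \<subseteq> (supp E c \<union> (\<Union>x\<in>insert x X. supp E (f x))) - insert x X"
    using w(3) w'(2) by blast
  ultimately show ?case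
    using w'(1) by blast
qed

lemma circuit_elimination:
  fixes W :: "('e \<Rightarrow> 'k::field) set"
  assumes sub: "coord.subspace W" and fin: "finite_dimensional W"
    and C: "C \<in> min_supports E W" and F: "\<And>x. x \<in> X \<Longrightarrow> F x \<in> min_supports E W"
    and diag: "\<And>x y. x \<in> X \<Longrightarrow> y \<in> X \<Longrightarrow> x \<in> F y \<longleftrightarrow> x = y"
    and z: "z \<in> C - (\<Union>x\<in>X. F x)"
  shows "\<exists>C'\<in>min_supports E W. z \<in> C' \<and> C' \<subseteq> (C \<union> (\<Union>x\<in>X. F x)) - X"
proof -
  obtain c where c: "c \<in> W" "C = supp E c"
    using C by (auto simp: min_supports_def supports_def)
  have "\<forall>x\<in>X. \<exists>v\<in>W. F x = supp E v"
    using F unfolding min_supports_def supports_def by blast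
  then obtain f where f: "\<And>x. x \<in> X \<Longrightarrow> f x \<in> W" "\<And>x. x \<in> X \<Longrightarrow> F x = supp E (f x)"
    by metis
  have diag': "x \<in> supp E (f y) \<longleftrightarrow> x = y" if "x \<in> X" "y \<in> X" for x y
    using diag f(2) that by blast
  have "finite X"
    using finite_if_diagonal[OF sub fin f(1) diag'] by blast
  moreover have "z \<in> supp E c" "\<And>x. x \<in> X \<Longrightarrow> z \<notin> supp E (f x)"
    using z c f(2) by auto
  ultimately obtain w where w: "w \<in> W" "z \<in> supp E w"
      "supp E w \<subseteq> (supp E c \<union> (\<Union>x\<in>X. supp E (f x))) - X"
    using eliminate_finite[OF sub c(1) _ f(1) diag'] by blast
  obtain C' where "C' \<in> min_supports E W" "z \<in> C'" "C' \<subseteq> supp E w"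
    using circuit_through_point[OF sub fin w(1,2)] by blast
  then show ?thesis
    using w(3) c(2) f(2) by (intro bexI[of _ C']) auto
qed

section \<open>Maximal independent sets\<close>

text \<open>Minimality of \<open>dim W\<^bsub>X - S\<^esub>\<close> over all finite \<open>S \<subseteq> X - I\<close> makes \<open>X - S\<close> independent.\<close>

lemma ex_cofinite_independent:
  fixes W :: "('e \<Rightarrow> 'k::field) set"
  assumes sub: "coord.subspace W" and fin: "finite_dimensional W"
    and I: "I \<in> indep_subsets E (min_supports E W)" and "I \<subseteq> X" "X \<subseteq> E"
  obtains S where "finite S" "S \<subseteq> X - I" "X - S \<in> indep_subsets E (min_supports E W)"
proof -
  define P where "P S \<longleftrightarrow> finite S \<and> S \<subseteq> X - I" for S
  have "P {}"
    by (simp add: P_def)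
  then obtain S where S: "P S"
    and least: "\<And>T. P T \<Longrightarrow> coord.dim (supported E W (X - S)) \<le> coord.dim (supported E W (X - T))"
    using ex_has_least_nat[of P "{}" "\<lambda>S. coord.dim (supported E W (X - S))"] by blast
  have "supp E v = {}" if v: "v \<in> supported E W (X - S)" for v
  proof (rule ccontr)
    assume "supp E v \<noteq> {}"
    then have "\<not> supp E v \<subseteq> I"
      using I v by (auto simp: indep_subsets_min_supports_iff[OF sub fin] supported_def)
    then obtain x where x: "x \<in> supp E v" "x \<notin> I"
      by blast
    have "coord.dim (supported E W ((X - S) - {x})) < coord.dim (supported E W (X - S))"
      by (rule dim_supported_Diff_less[OF sub fin v x(1)])
    moreover have "(X - S) - {x} = X - insert x S"
      by blast
    moreover have "P (insert x S)"
      using S x v by (auto simp: P_def supported_def)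
    ultimately show False
      using least[of "insert x S"] by simp
  qed
  then have "X - S \<in> indep_subsets E (min_supports E W)"
    using \<open>X \<subseteq> E\<close> by (auto simp: indep_subsets_min_supports_iff[OF sub fin])
  then show thesis
    using that S by (auto simp: P_def)
qed

lemma ex_maximal_independent:
  fixes W :: "('e \<Rightarrow> 'k::field) set"
  assumes sub: "coord.subspace W" and fin: "finite_dimensional W"
    and I: "I \<in> indep_subsets E (min_supports E W)" and "I \<subseteq> X" "X \<subseteq> E"
  shows "\<exists>M \<in> {I' \<in> indep_subsets E (min_supports E W). I \<subseteq> I' \<and> I' \<subseteq> X}.
    \<forall>N \<in> {I' \<in> indep_subsets E (min_supports E W). I \<subseteq> I' \<and> I' \<subseteq> X}. M \<subseteq> N \<longrightarrow> N = M"
proof -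
  define P where "P S \<longleftrightarrow>
    finite S \<and> S \<subseteq> X - I \<and> X - S \<in> indep_subsets E (min_supports E W)" for S
  obtain S0 where "finite S0" "S0 \<subseteq> X - I" "X - S0 \<in> indep_subsets E (min_supports E W)"
    by (rule ex_cofinite_independent[OF assms])
  then have "P S0"
    unfolding P_def by (intro conjI)
  then obtain S where S: "P S" and least: "\<And>T. P T \<Longrightarrow> card S \<le> card T"
    using ex_has_least_nat[of P S0 card] by blast
  have max: "N = X - S"
    if N: "N \<in> indep_subsets E (min_supports E W)" "I \<subseteq> N" "N \<subseteq> X" "X - S \<subseteq> N" for N
  proof -
    have XN: "X - (X - N) = N"
      using N(3) by blast
    have finS: "finite S"
      using S by (simp add: P_def)
    have sub': "X - N \<subseteq> S"
      using N(4) by blast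
    have "X - N \<subseteq> X - I"
      using N(2) by blast
    then have "P (X - N)"
      unfolding P_def XN using N(1) finite_subset[OF sub' finS] by (intro conjI)
    then have "card S \<le> card (X - N)"
      by (rule least)
    then have "X - N = S"
      by (rule card_seteq[OF finS sub'])
    then show ?thesis
      using XN by simp
  qed
  show ?thesis
  proof (intro bexI ballI impI)
    show "X - S \<in> {I' \<in> indep_subsets E (min_supports E W). I \<subseteq> I' \<and> I' \<subseteq> X}"
      using S \<open>I \<subseteq> X\<close> unfolding P_def by blast
    show "N = X - S"
      if "N \<in> {I' \<in> indep_subsets E (min_supports E W). I \<subseteq> I' \<and> I' \<subseteq> X}" "X - S \<subseteq> N" for N
      using that max by simp
  qed
qed

section \<open>The matroid of a finite-dimensional space\<close>

theorem theorem2p16: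
  fixes E :: "'e set" and W :: "('e \<Rightarrow> 'k::field) set"
  assumes "E \<noteq> {}"
    and "W \<subseteq> coord_space E"
    and "coord.subspace W"
    and "finite_dimensional W"
    and "W \<noteq> {0}"
  shows "matroid_circuits E (min_supports E W) \<and>
    (\<forall>A \<in> supports E W. \<exists>\<D> \<subseteq> min_supports E W. A = \<Union>\<D>)"
proof
  show "matroid_circuits E (min_supports E W)"
    unfolding matroid_circuits_def
  proof (intro conjI)
    show "min_supports E W \<subseteq> Pow E"
      by (auto simp: min_supports_def supports_def supp_def)
    show "{} \<notin> min_supports E W"
      by (simp add: min_supports_def)
    show "\<forall>C\<in>min_supports E W. \<forall>D\<in>min_supports E W. \<not> C \<subset> D"
      unfolding min_supports_def by blast
    show "\<forall>C\<in>min_supports E W. \<forall>X F. X \<subseteq> C \<longrightarrow> (\<forall>x\<in>X. F x \<in> min_supports E W) \<longrightarrow>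
        (\<forall>x\<in>X. \<forall>y\<in>X. x \<in> F y \<longleftrightarrow> x = y) \<longrightarrow>
        (\<forall>z \<in> C - (\<Union>x\<in>X. F x). \<exists>C'\<in>min_supports E W.
          z \<in> C' \<and> C' \<subseteq> (C \<union> (\<Union>x\<in>X. F x)) - X)"
    proof (intro ballI allI impI)
      fix C X F z
      assume "C \<in> min_supports E W" "\<forall>x\<in>X. F x \<in> min_supports E W"
        "\<forall>x\<in>X. \<forall>y\<in>X. x \<in> F y \<longleftrightarrow> x = y" "z \<in> C - (\<Union>x\<in>X. F x)"
      then show "\<exists>C'\<in>min_supports E W. z \<in> C' \<and> C' \<subseteq> (C \<union> (\<Union>x\<in>X. F x)) - X"
        using circuit_elimination[OF assms(3,4), where C = C and X = X and F = F and z = z] by simp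
    qed
    show "\<forall>I X. I \<in> indep_subsets E (min_supports E W) \<longrightarrow> I \<subseteq> X \<longrightarrow> X \<subseteq> E \<longrightarrow>
        (\<exists>M \<in> {I' \<in> indep_subsets E (min_supports E W). I \<subseteq> I' \<and> I' \<subseteq> X}.
           \<forall>N \<in> {I' \<in> indep_subsets E (min_supports E W). I \<subseteq> I' \<and> I' \<subseteq> X}.
             M \<subseteq> N \<longrightarrow> N = M)"
      by (intro allI impI ex_maximal_independent[OF assms(3,4)])
  qed
  show "\<forall>A \<in> supports E W. \<exists>\<D> \<subseteq> min_supports E W. A = \<Union>\<D>"
    using support_eq_Union_circuits[OF assms(3,4)] by blast
qed

end
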